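(* Let $f\in K[X,Y]$ be irreducible and monic in $Y$, and write $f=f_0\widetilde{f}=f_0f_1\cdots f_r$, where $f_0\in K[[X]][Y]$ is a unit in $K[[X,Y]]$ and $f_1,\dots,f_r\in K[[X]][Y]$ are irreducible Weierstrass polynomials. For $i=1,\dots,r$, let $m_i=\deg_Yf_i$, set $h_i=\prod_{j=1,\,j\neq i}^rf_j$, and let $$\mathcal{B}^{(i)}=\left\{1=p_0^{(i)},\frac{p_1^{(i)}}{X^{e_1^{(i)}}},\ldots,\frac{p_{m_i-1}^{(i)}}{X^{e_{m_i-1}^{(i)}}}\right\}$$ represent an integral basis for $f_i$, where $p_d^{(i)}\in K[[X]][Y]$ is monic of degree $d$ in $Y$ and the $e_d^{(i)}$ are integers. Furthermore, for each $i$, let $\beta_i\in K[X,Y]$ be a polynomial such that $\upsilon_{f_i}(\beta_ih_i)$ is an integer $c_i\geq0$, and set $$\widetilde{\mathcal{B}}^{(i)}=\left\{\frac{\beta_ih_i}{X^{c_i}},\frac{\beta_ih_ip_1^{(i)}}{X^{c_i+e_1^{(i)}}},\ldots,\frac{\beta_ih_ip_{m_i-1}^{(i)}}{X^{c_i+e_{m_i-1}^{(i)}}}\right\}.$$ Then $\widetilde{\mathcal{B}}^{(1)}\cup\ldots\cup\widetilde{\mathcal{B}}^{(r)}$ represents an integral basis for $\widetilde{f}=f_1\cdots f_r$.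
   Context: $K$ is a field of characteristic zero and $K\subset L$ is a field extension with $L$ algebraically closed. $L\{\{X\}\}=\bigcup_{k\ge1}L((X^{1/k}))$ is the (algebraically closed) field of Puiseux series over $L$. For $\gamma\in L\{\{X\}\}\setminus\{0\}$, $\upsilon(\gamma)\in\mathbb{Q}$ is the smallest exponent appearing in a term of $\gamma$; $\upsilon(0)=\infty$. For a square-free monic $g\in K[[X]][Y]$ of degree $m\ge1$ in $Y$ with roots (Puiseux expansions) $\gamma_1,\dots,\gamma_m\in L\{\{X\}\}$ and $q\in L\{\{X\}\}[Y]$, put $\upsilon_g(q)=\min_{1\le i\le m}\upsilon(q(X,\gamma_i))$. A Weierstrass polynomial is a polynomial in $K[[X]][Y]$, monic in $Y$, whose non-leading coefficients vanish at $X=0$. For such $g$ let $B=K[[x]][y]=K[[X]][Y]/\langle g\rangle$, with $x,y$ the residue classes of $X,Y$. The normalization $\overline{B}$ is the integral closure of $B$ in its total ring of fractions $K((X))[Y]/\langle g\rangle$; it is a free $K[[x]]$-module of rank $m$. An integral basis for $g$ is a set of free generators of $\overline{B}$ over $K[[x]]$. A set of elements of $K((X))[Y]$ represents an integral basis for $g$ if their residue classes modulo $g$ form an integral basis for $g$. *)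

theory Defs
  imports
    "HOL-Computational_Algebra.Computational_Algebra"
    "HOL-Number_Theory.Cong"
    "HOL-Library.Extended_Real"
begin

section \<open>Puiseux series\<close>

text \<open>
  The field of Puiseux series is the union of the fields of Laurent series in \<open>X\<^sup>1\<^sup>/\<^sup>k\<close>
  over all \<open>k \<ge> 1\<close>.  The pair \<open>(k, F)\<close> stands for \<open>F(X\<^sup>1\<^sup>/\<^sup>k)\<close>; two pairs are identified
  if they agree after passing to a common denominator of the exponents.
\<close>

definition puiseux_rel :: "nat \<times> 'a::zero fls \<Rightarrow> nat \<times> 'a fls \<Rightarrow> bool" where
  "puiseux_rel = (\<lambda>(k, F) (l, G). k > 0 \<and> l > 0 \<and>
     fls_compose_power F l = fls_compose_power G k)"

lemma fls_compose_power_assoc: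
  "fls_compose_power (fls_compose_power F k) l = fls_compose_power F (k * l)"
proof (cases "k > 0 \<and> l > 0")
  case True
  have "fls_nth (fls_compose_power (fls_compose_power F k) l) n = fls_nth (fls_compose_power F (k * l)) n" for n
  proof (cases "int l dvd n")
    case l: True
    then obtain m where "n = int l * m" by auto
    with True show ?thesis by (auto simp: fls_nth_compose_power mult.commute)
  next
    case False
    then have "\<not> int (k * l) dvd n" by (metis dvd_mult_right of_nat_mult)
    with True False show ?thesis by (simp add: fls_nth_compose_power del: of_nat_mult)
  qed
  then show ?thesis by (simp add: fls_eq_iff)
qed auto

lemma fls_compose_power_inject:
  assumes "k > 0"
  shows "fls_compose_power F k = fls_compose_power G k \<longleftrightarrow> F = G"
proof
  assume eq: "fls_compose_power F k = fls_compose_power G k"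
  have "fls_nth F n = fls_nth G n" for n
    using arg_cong[OF eq, of "\<lambda>H. fls_nth H (int k * n)"] assms by (simp add: fls_nth_compose_power)
  then show "F = G" by (simp add: fls_eq_iff)
qed simp

lemma fls_compose_power_eq_0_iff:
  "k > 0 \<Longrightarrow> fls_compose_power F k = 0 \<longleftrightarrow> F = 0"
  using fls_compose_power_inject[of k F 0] by simp

lemma fls_compose_power_by_1: "fls_compose_power F (Suc 0) = F"
  by (rule fls_eqI) (simp add: fls_nth_compose_power)

lemma fls_subdegree_compose_power:
  assumes "k > 0"
  shows "fls_subdegree (fls_compose_power F k) = int k * fls_subdegree F"
proof (cases "F = 0")
  case False
  show ?thesis
  proof (rule fls_subdegree_eqI)
    show "fls_nth (fls_compose_power F k) (int k * fls_subdegree F) \<noteq> 0"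
      using assms False by (simp add: fls_nth_compose_power)
  next
    fix n assume n: "n < int k * fls_subdegree F"
    show "fls_nth (fls_compose_power F k) n = 0"
    proof (cases "int k dvd n")
      case True
      then obtain m where m: "n = int k * m" by auto
      with n assms have "m < fls_subdegree F" by simp
      with m assms show ?thesis by (simp add: fls_nth_compose_power)
    qed (use assms in \<open>simp add: fls_nth_compose_power\<close>)
  qed
qed simp

lemma fls_compose_power_inverse:
  assumes "k > 0"
  shows "fls_compose_power (inverse F) k = inverse (fls_compose_power F k :: 'a::field fls)"
proof (cases "F = 0")
  case False
  have "fls_compose_power F k * fls_compose_power (inverse F) k = 1"
    using False assms by (simp flip: fls_compose_power_mult)
  then show ?thesis by (metis inverse_unique)
qed simp

lemma part_equivp_puiseux_rel: "part_equivp (puiseux_rel :: _ \<times> 'a::zero_neq_one fls \<Rightarrow> _)"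
proof (rule part_equivpI)
  show "\<exists>x :: nat \<times> 'a fls. puiseux_rel x x"
    by (rule exI[of _ "(1, 0)"]) (simp add: puiseux_rel_def)
  show "symp (puiseux_rel :: _ \<times> 'a fls \<Rightarrow> _)"
    by (auto simp: symp_def puiseux_rel_def)
  show "transp (puiseux_rel :: _ \<times> 'a fls \<Rightarrow> _)"
  proof (rule transpI, clarsimp simp: puiseux_rel_def)
    fix k l m and F G H :: "'a fls"
    assume pos: "k > 0" "l > 0" "m > 0"
      and FG: "fls_compose_power F l = fls_compose_power G k"
      and GH: "fls_compose_power G m = fls_compose_power H l"
    have "fls_compose_power (fls_compose_power F m) l = fls_compose_power (fls_compose_power F l) m"
      by (simp add: fls_compose_power_assoc mult.commute)
    also have "\<dots> = fls_compose_power (fls_compose_power G m) k"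
      unfolding FG by (simp add: fls_compose_power_assoc mult.commute)
    also have "\<dots> = fls_compose_power (fls_compose_power H k) l"
      unfolding GH by (simp add: fls_compose_power_assoc mult.commute)
    finally show "fls_compose_power F m = fls_compose_power H k"
      using pos by (simp add: fls_compose_power_inject)
  qed
qed

quotient_type (overloaded) 'a puiseux = "nat \<times> 'a::field fls" / partial: puiseux_rel
  by (rule part_equivp_puiseux_rel)

lemma fls_compose_power_cross:
  assumes "fls_compose_power F l = fls_compose_power G k"
  shows "fls_compose_power F (l * n) = fls_compose_power G (k * n)"
  using assms by (metis fls_compose_power_assoc)

instantiation puiseux :: (field) field
begin

lift_definition zero_puiseux :: "'a puiseux" is "(1, 0)"
  by (simp add: puiseux_rel_def)

lift_definition one_puiseux :: "'a puiseux" is "(1, 1)"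
  by (simp add: puiseux_rel_def)

lift_definition plus_puiseux :: "'a puiseux \<Rightarrow> 'a puiseux \<Rightarrow> 'a puiseux" is
  "\<lambda>(k, F) (l, G). (k * l, fls_compose_power F l + fls_compose_power G k)"
proof (clarsimp simp: puiseux_rel_def fls_compose_power_assoc)
  fix k k' l l' and F F' G G' :: "'a fls"
  assume F: "fls_compose_power F k' = fls_compose_power F' k"
    and G: "fls_compose_power G l' = fls_compose_power G' l"
  show "fls_compose_power F (l * (k' * l')) + fls_compose_power G (k * (k' * l')) =
        fls_compose_power F' (l' * (k * l)) + fls_compose_power G' (k' * (k * l))"
    using fls_compose_power_cross[OF F, of "l * l'"] fls_compose_power_cross[OF G, of "k * k'"]
    by (simp add: mult_ac)
qed

lift_definition uminus_puiseux :: "'a puiseux \<Rightarrow> 'a puiseux" is "\<lambda>(k, F). (k, - F)"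
  by (auto simp: puiseux_rel_def)

definition minus_puiseux :: "'a puiseux \<Rightarrow> 'a puiseux \<Rightarrow> 'a puiseux" where
  "minus_puiseux x y = x + (- y)"

lift_definition times_puiseux :: "'a puiseux \<Rightarrow> 'a puiseux \<Rightarrow> 'a puiseux" is
  "\<lambda>(k, F) (l, G). (k * l, fls_compose_power F l * fls_compose_power G k)"
proof (clarsimp simp: puiseux_rel_def fls_compose_power_assoc)
  fix k k' l l' and F F' G G' :: "'a fls"
  assume F: "fls_compose_power F k' = fls_compose_power F' k"
    and G: "fls_compose_power G l' = fls_compose_power G' l"
  show "fls_compose_power F (l * (k' * l')) * fls_compose_power G (k * (k' * l')) =
        fls_compose_power F' (l' * (k * l)) * fls_compose_power G' (k' * (k * l))"
    using fls_compose_power_cross[OF F, of "l * l'"] fls_compose_power_cross[OF G, of "k * k'"]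
    by (simp add: mult_ac)
qed

lift_definition inverse_puiseux :: "'a puiseux \<Rightarrow> 'a puiseux" is "\<lambda>(k, F). (k, inverse F)"
  by (auto simp: puiseux_rel_def fls_compose_power_inverse)

definition divide_puiseux :: "'a puiseux \<Rightarrow> 'a puiseux \<Rightarrow> 'a puiseux" where
  "divide_puiseux x y = x * inverse y"

instance
proof
  fix x y z :: "'a puiseux"
  show "x * y * z = x * (y * z)"
    by transfer (auto simp: puiseux_rel_def fls_compose_power_assoc mult_ac)
  show "x * y = y * x"
    by transfer (auto simp: puiseux_rel_def fls_compose_power_assoc mult_ac)
  show "1 * x = x"
    by transfer (auto simp: puiseux_rel_def fls_compose_power_assoc mult_ac)
  show "x + y + z = x + (y + z)"
    by transfer (auto simp: puiseux_rel_def fls_compose_power_assoc mult_ac add_ac)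
  show "x + y = y + x"
    by transfer (auto simp: puiseux_rel_def fls_compose_power_assoc mult_ac add_ac)
  show "0 + x = x"
    by transfer (auto simp: puiseux_rel_def fls_compose_power_assoc mult_ac)
  show "- x + x = 0"
    by transfer (auto simp: puiseux_rel_def fls_compose_power_assoc)
  show "x - y = x + - y"
    by (simp add: minus_puiseux_def)
  show "(x + y) * z = x * z + y * z"
    by transfer (auto simp: puiseux_rel_def fls_compose_power_assoc algebra_simps)
  show "(0 :: 'a puiseux) \<noteq> 1"
    by transfer (simp add: puiseux_rel_def)
  show "inverse x * x = 1" if "x \<noteq> 0"
    using that
  proof (transfer, goal_cases)
    case (1 x)
    then show ?case
      by (cases x) (simp add: puiseux_rel_def fls_compose_power_inverse fls_compose_power_eq_0_iff
        fls_compose_power_by_1)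
  qed
  show "x div y = x * inverse y"
    by (simp add: divide_puiseux_def)
  show "inverse (0 :: 'a puiseux) = 0"
    by transfer (simp add: puiseux_rel_def)
qed

end

definition puiseux_of_fls :: "'a::field fls \<Rightarrow> 'a puiseux" where
  "puiseux_of_fls F = abs_puiseux (1, F)"

text \<open>The exponents occurring in \<open>F(X\<^sup>1\<^sup>/\<^sup>k)\<close> are the \<open>n / k\<close> with \<open>fls_nth F n \<noteq> 0\<close>.\<close>

lift_definition puiseux_val :: "'a::field puiseux \<Rightarrow> ereal" is
  "\<lambda>(k, F). if F = 0 then \<infinity> else ereal (of_int (fls_subdegree F) / of_nat k)"
proof (goal_cases)
  case (1 x y)
  obtain k F where x: "x = (k, F)" by (cases x)
  obtain l G where y: "y = (l, G)" by (cases y)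
  have kl: "k > 0" "l > 0" and eq: "fls_compose_power F l = fls_compose_power G k"
    using 1 by (simp_all add: puiseux_rel_def x y)
  have "F = 0 \<longleftrightarrow> G = 0"
    using kl eq by (metis fls_compose_power_eq_0_iff)
  moreover have "int l * fls_subdegree F = int k * fls_subdegree G"
    using kl eq by (metis fls_subdegree_compose_power)
  then have "real l * of_int (fls_subdegree F) = real k * of_int (fls_subdegree G)"
    by (metis of_int_mult of_int_of_nat_eq)
  then have "of_int (fls_subdegree F) / real k = of_int (fls_subdegree G) / real l"
    using kl by (simp add: field_simps)
  ultimately show ?case by (simp add: x y)
qed


section \<open>Embeddings and the valuation along the roots\<close>

definition fps_to_puiseux :: "('a::zero \<Rightarrow> 'b::field) \<Rightarrow> 'a fps \<Rightarrow> 'b puiseux" where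
  "fps_to_puiseux \<iota> F = puiseux_of_fls (fps_to_fls (Abs_fps (\<lambda>n. \<iota> (fps_nth F n))))"

text \<open>
  A nonzero \<open>g\<close> has only finitely many roots, so the infimum is a minimum whenever \<open>g\<close> has a root.
\<close>

definition val_along :: "'a::field puiseux poly \<Rightarrow> 'a puiseux poly \<Rightarrow> ereal" where
  "val_along g q = (INF \<gamma>\<in>{\<gamma>. poly g \<gamma> = 0}. puiseux_val (poly q \<gamma>))"

definition weierstrass_poly :: "'a::comm_ring_1 fps poly \<Rightarrow> bool" where
  "weierstrass_poly g \<longleftrightarrow> lead_coeff g = 1 \<and> (\<forall>n<degree g. fps_nth (coeff g n) 0 = 0)"

abbreviation to_fps_poly :: "'a::comm_ring_1 poly poly \<Rightarrow> 'a fps poly" where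
  "to_fps_poly \<equiv> map_poly fps_of_poly"

abbreviation to_fls_poly :: "'a::comm_ring_1 fps poly \<Rightarrow> 'a fls poly" where
  "to_fls_poly \<equiv> map_poly fps_to_fls"

definition over_X_power :: "'a::field fps poly \<Rightarrow> int \<Rightarrow> 'a fls poly" where
  "over_X_power q e = smult (1 / fls_X powi e) (to_fls_poly q)"


section \<open>Integral bases\<close>

text \<open>
  Elements of \<open>K((X))[Y]/\<langle>g\<rangle>\<close> are given by representatives in \<open>K((X))[Y]\<close>, and equality in the
  quotient is congruence modulo \<open>g\<close>.  For monic \<open>g\<close> the ring \<open>B = K[[X]][Y]/\<langle>g\<rangle>\<close> embeds into
  this quotient, and \<open>normalization g\<close> consists of all representatives of elements that are
  roots of a monic polynomial with coefficients in \<open>B\<close>.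
\<close>

definition normalization :: "'a::field fps poly \<Rightarrow> 'a fls poly set" where
  "normalization g = {q. \<exists>P :: 'a fps poly poly. lead_coeff P = 1 \<and>
     [poly (map_poly to_fls_poly P) q = 0] (mod to_fls_poly g)}"

text \<open>
  Freeness makes the residue map injective on \<open>S\<close>: if \<open>s\<close> and \<open>s'\<close> are distinct and congruent,
  then \<open>1 \<cdot> s + (-1) \<cdot> s'\<close> is a nontrivial relation.
\<close>

definition represents_integral_basis :: "'a::field fps poly \<Rightarrow> 'a fls poly set \<Rightarrow> bool" where
  "represents_integral_basis g S \<longleftrightarrow>
     finite S \<and> S \<subseteq> normalization g \<and>
     (\<forall>q\<in>normalization g. \<exists>a :: 'a fls poly \<Rightarrow> 'a fps.
        [q = (\<Sum>s\<in>S. smult (fps_to_fls (a s)) s)] (mod to_fls_poly g)) \<and>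
     (\<forall>a :: 'a fls poly \<Rightarrow> 'a fps.
        [(\<Sum>s\<in>S. smult (fps_to_fls (a s)) s) = 0] (mod to_fls_poly g) \<longrightarrow> (\<forall>s\<in>S. a s = 0))"

end

theory Submission
  imports Defs
begin

text \<open>
  Let \<open>g = f\<^sub>i\<close> be one of the factors, \<open>\<gamma>\<close> one of its Puiseux roots, and \<open>V\<close> the ring of Puiseux series of
  nonnegative valuation.  The proof rests on a description of the normalization of \<open>g\<close> as a
  valuation ring: \<open>q\<close> is integral modulo \<open>g\<close> if and only if \<open>q(\<gamma>) \<in> V\<close> (\<open>normalization_iff\<close>).

  One direction says that \<open>V\<close> is integrally closed.  For the other, some nonzero polynomial \<open>F\<close> over
  \<open>K[[X]]\<close> satisfies \<open>F(q) = 0\<close> modulo \<open>g\<close> for reasons of dimension, and \<open>F\<close> may be taken nonzero modulo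
  \<open>X\<close>.  Weierstrass preparation (\<open>weierstrass_preparation_poly\<close>) factors \<open>F\<close>, up to a constant, as
  \<open>G * H\<close> with \<open>G\<close> monic and \<open>H\<close> congruent to \<open>1\<close> modulo \<open>X\<close>.  By Gauss's lemma
  (\<open>prime_elem_to_fls_poly\<close>) \<open>g\<close> remains prime over \<open>K((X))\<close>, so \<open>g\<close> divides \<open>G(q)\<close> or \<open>H(q)\<close>; but
  \<open>H(q(\<gamma>))\<close> is \<open>1\<close> plus an element of positive valuation, so \<open>G(q)\<close> vanishes modulo \<open>g\<close> and \<open>q\<close> is integral.

  Now let \<open>w\<^sub>i\<close> be the quotient of \<open>\<beta>\<^sub>i h\<^sub>i\<close> by the \<open>c\<^sub>i\<close>-th power of \<open>X\<close>.  The hypothesis on \<open>c\<^sub>i\<close> provides a root \<open>\<gamma>\<close> of \<open>f\<^sub>i\<close> at which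
  \<open>w\<^sub>i\<close> has valuation zero.  Hence \<open>w\<^sub>i\<close> and its inverse modulo \<open>f\<^sub>i\<close> both lie in the normalization of
  \<open>f\<^sub>i\<close>, that is, \<open>w\<^sub>i\<close> is a unit there, whereas \<open>w\<^sub>i\<close> vanishes modulo every other \<open>f\<^sub>j\<close>.  The normalization
  of the product is the product of the normalizations, so the sets \<open>w\<^sub>i * B\<^sub>i\<close> together form a basis
  (\<open>represents_integral_basis_prod\<close>); and these are the sets in the statement.
\<close>

section \<open>Ring homomorphisms and their action on coefficients\<close>

locale unital_ring_hom =
  fixes h :: "'a::comm_ring_1 \<Rightarrow> 'b::comm_ring_1"
  assumes hom_add: "h (a + b) = h a + h b"
    and hom_mult: "h (a * b) = h a * h b"
    and hom_one: "h 1 = 1"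
begin

lemma hom_zero: "h 0 = 0"
  using hom_add[of 0 0] by simp

lemma hom_uminus: "h (- a) = - h a"
  using hom_add[of a "- a"] by (simp add: hom_zero eq_neg_iff_add_eq_0 add.commute)

lemma hom_diff: "h (a - b) = h a - h b"
  using hom_add[of a "- b"] by (simp add: hom_uminus)

lemma hom_sum: "h (sum f I) = (\<Sum>i\<in>I. h (f i))"
  by (induction I rule: infinite_finite_induct) (simp_all add: hom_zero hom_add)

lemma hom_prod: "h (prod f I) = (\<Prod>i\<in>I. h (f i))"
  by (induction I rule: infinite_finite_induct) (simp_all add: hom_one hom_mult)

lemma hom_dvd: "a dvd b \<Longrightarrow> h a dvd h b"
  by (auto simp: dvd_def hom_mult)

lemma coeff_map_poly_hom [simp]: "coeff (map_poly h p) i = h (coeff p i)"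
  by (simp add: coeff_map_poly hom_zero)

lemma map_poly_hom_mult: "map_poly h (p * q) = map_poly h p * map_poly h q"
  by (rule poly_eqI) (simp add: coeff_mult hom_sum hom_mult)

lemma unital_ring_hom_map_poly: "unital_ring_hom (map_poly h)"
  by unfold_locales
    (auto intro!: poly_eqI simp: hom_add map_poly_hom_mult hom_one)

lemma map_poly_hom_smult: "map_poly h (smult a p) = smult (h a) (map_poly h p)"
  by (rule poly_eqI) (simp add: hom_mult)

lemma map_poly_hom_pCons: "map_poly h (pCons a p) = pCons (h a) (map_poly h p)"
  by (rule poly_eqI) (simp add: coeff_pCons split: nat.split)

lemma map_poly_hom_pcompose: "map_poly h (pcompose p q) = pcompose (map_poly h p) (map_poly h q)"
proof -
  interpret H: unital_ring_hom "map_poly h" by (rule unital_ring_hom_map_poly)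
  show ?thesis
    by (induction p) (simp_all add: pcompose_pCons map_poly_hom_pCons H.hom_add H.hom_mult H.hom_zero hom_zero)
qed

lemma hom_poly: "h (poly p a) = poly (map_poly h p) (h a)"
  by (induction p) (simp_all add: map_poly_hom_pCons hom_zero hom_add hom_mult)

end

section \<open>Weierstrass preparation for polynomials over power series\<close>

interpretation fps_to_fls_hom: unital_ring_hom "fps_to_fls :: 'a::field fps \<Rightarrow> 'a fls"
  by unfold_locales (simp_all add: fls_times_fps_to_fls)

interpretation to_fls_poly_hom: unital_ring_hom "to_fls_poly :: 'a::field fps poly \<Rightarrow> 'a fls poly"
  by (rule fps_to_fls_hom.unital_ring_hom_map_poly)

interpretation const_coeff_hom: unital_ring_hom "\<lambda>c :: 'a::field fps. fps_nth c 0"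
  by unfold_locales simp_all

interpretation reduction_hom: unital_ring_hom "map_poly (\<lambda>c :: 'a::field fps. fps_nth c 0)"
  by (rule const_coeff_hom.unital_ring_hom_map_poly)

abbreviation reduction :: "'a::field fps poly \<Rightarrow> 'a poly" where
  "reduction \<equiv> map_poly (\<lambda>c. fps_nth c 0)"


definition X_coeff :: "nat \<Rightarrow> 'a::field fps poly \<Rightarrow> 'a poly" where
  "X_coeff k F = map_poly (\<lambda>c. fps_nth c k) F"

lemma coeff_X_coeff [simp]: "coeff (X_coeff k F) i = fps_nth (coeff F i) k"
  by (simp add: X_coeff_def coeff_map_poly)

lemma X_coeff_0: "X_coeff 0 F = reduction F"
  by (simp add: X_coeff_def)

lemma X_coeff_mult: "X_coeff k (G * H) = (\<Sum>j=0..k. X_coeff j G * X_coeff (k - j) H)"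
proof (rule poly_eqI)
  fix m
  have "coeff (X_coeff k (G * H)) m =
      (\<Sum>i\<le>m. \<Sum>j=0..k. fps_nth (coeff G i) j * fps_nth (coeff H (m - i)) (k - j))"
    by (simp add: coeff_mult fps_sum_nth fps_mult_nth)
  also have "\<dots> = (\<Sum>j=0..k. \<Sum>i\<le>m. fps_nth (coeff G i) j * fps_nth (coeff H (m - i)) (k - j))"
    by (rule sum.swap)
  finally show "coeff (X_coeff k (G * H)) m = coeff (\<Sum>j=0..k. X_coeff j G * X_coeff (k - j) H) m"
    by (simp add: coeff_sum coeff_mult)
qed

lemma poly_eq_if_X_coeff_eq: "(\<And>k. X_coeff k F = X_coeff k G) \<Longrightarrow> F = G"
  by (metis coeff_X_coeff fps_ext poly_eqI)

lemma ex_poly_with_X_coeffs: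
  fixes W :: "nat \<Rightarrow> 'a::field poly"
  assumes "\<And>k. degree (W k) \<le> n"
  shows "\<exists>F. \<forall>k. X_coeff k F = W k"
proof -
  define F where "F = (\<Sum>i\<le>n. monom (Abs_fps (\<lambda>k. coeff (W k) i)) i)"
  have "X_coeff k F = W k" for k
  proof (rule poly_eqI)
    fix i
    have "coeff F i = (if i \<le> n then Abs_fps (\<lambda>k. coeff (W k) i) else 0)"
      by (simp add: F_def coeff_sum)
    then show "coeff (X_coeff k F) i = coeff (W k) i"
      using assms[of k] by (auto simp: coeff_eq_0)
  qed
  then show ?thesis by blast
qed

text \<open>
  Comparing coefficients of \<open>X\<^sup>k\<close> in \<open>F = G * H\<close> under the normalization \<open>G\<^sub>0 = F\<^sub>0\<close>, \<open>H\<^sub>0 = 1\<close> gives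
  \<open>F\<^sub>k = G\<^sub>k + F\<^sub>0 * H\<^sub>k + (\<Sum>0<i<k. G\<^sub>i * H\<^sub>k\<^sub>-\<^sub>i)\<close>.  Division with remainder by \<open>F\<^sub>0\<close> solves this
  for \<open>(G\<^sub>k, H\<^sub>k)\<close>, and makes \<open>deg G\<^sub>k < deg F\<^sub>0\<close> for \<open>k > 0\<close>.
\<close>

function prep_coeffs :: "(nat \<Rightarrow> 'a::field poly) \<Rightarrow> nat \<Rightarrow> 'a poly \<times> 'a poly" where
  "prep_coeffs F k =
    (if k = 0 then (F 0, 1)
     else let r = F k - (\<Sum>i\<in>{0<..<k}. fst (prep_coeffs F i) * snd (prep_coeffs F (k - i)))
          in (r mod F 0, r div F 0))"
  by auto
termination
  by (relation "measure snd") auto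

declare prep_coeffs.simps [simp del]

lemma prep_coeffs_0: "prep_coeffs F 0 = (F 0, 1)"
  by (simp add: prep_coeffs.simps)

lemma prep_coeffs_convolution:
  "(\<Sum>i=0..k. fst (prep_coeffs F i) * snd (prep_coeffs F (k - i))) = F k"
proof (cases "k = 0")
  case False
  define r where "r = F k - (\<Sum>i\<in>{0<..<k}. fst (prep_coeffs F i) * snd (prep_coeffs F (k - i)))"
  have k: "prep_coeffs F k = (r mod F 0, r div F 0)"
    using False by (subst prep_coeffs.simps) (simp add: r_def Let_def)
  have "{0..k} = insert 0 (insert k {0<..<k})" by auto
  then show ?thesis
    using False by (simp add: k prep_coeffs_0 r_def[symmetric] algebra_simps)
      (simp add: r_def)
qed (simp add: prep_coeffs_0)

text \<open>
  The bound on the second component is what makes the recursion produce a polynomial cofactor \<open>H\<close>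
  rather than a series in \<open>X\<close> whose coefficients have unbounded degree: the products \<open>G\<^sub>i * H\<^sub>k\<^sub>-\<^sub>i\<close> never exceed
  degree \<open>n\<close>, so the quotient by \<open>F\<^sub>0\<close> has degree at most \<open>n - deg F\<^sub>0\<close>.
\<close>

lemma degree_prep_coeffs:
  assumes n: "\<And>k. degree (F k) \<le> n" and F0: "F 0 \<noteq> 0"
  shows "degree (fst (prep_coeffs F k)) \<le> degree (F 0) \<and>
         (k > 0 \<longrightarrow> fst (prep_coeffs F k) = 0 \<or> degree (fst (prep_coeffs F k)) < degree (F 0)) \<and>
         degree (snd (prep_coeffs F k)) \<le> n - degree (F 0)"
proof (induction k rule: less_induct)
  case (less k)
  define d where "d = degree (F 0)"
  have dn: "d \<le> n" using n[of 0] by (simp add: d_def)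
  show ?case
  proof (cases "k = 0")
    case False
    define r where "r = F k - (\<Sum>i\<in>{0<..<k}. fst (prep_coeffs F i) * snd (prep_coeffs F (k - i)))"
    have k: "prep_coeffs F k = (r mod F 0, r div F 0)"
      using False by (subst prep_coeffs.simps) (simp add: r_def Let_def)
    have "degree (fst (prep_coeffs F i) * snd (prep_coeffs F (k - i))) \<le> n" if "i \<in> {0<..<k}" for i
    proof -
      have "degree (fst (prep_coeffs F i)) \<le> d" "degree (snd (prep_coeffs F (k - i))) \<le> n - d"
        using less.IH[of i] less.IH[of "k - i"] that by (auto simp: d_def)
      then show ?thesis
        using degree_mult_le[of "fst (prep_coeffs F i)" "snd (prep_coeffs F (k - i))"] dn by linarith
    qed
    then have r: "degree r \<le> n"
      unfolding r_def using n by (intro degree_diff_le degree_sum_le) auto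
    have m: "r mod F 0 = 0 \<or> degree (r mod F 0) < d"
      unfolding d_def using F0 by (rule degree_mod_less)
    have q: "degree (r div F 0) \<le> n - d"
    proof (cases "r div F 0 = 0")
      case False
      have "degree (r div F 0 * F 0) = degree (r div F 0) + d"
        using False F0 by (simp add: degree_mult_eq d_def)
      moreover have "r div F 0 * F 0 = r - r mod F 0" by (simp add: minus_mod_eq_div_mult)
      moreover have "degree (r - r mod F 0) \<le> n"
        using m r dn by (intro degree_diff_le) auto
      ultimately show ?thesis by simp
    qed simp
    show ?thesis
      using m q by (auto simp: k d_def)
  qed (simp add: prep_coeffs_0)
qed

text \<open>
  This is the only form of Hensel's lemma that is needed: it lifts the factorization of the residue
  of \<open>F\<close> into itself times \<open>1\<close>.  The cofactor \<open>H\<close> is congruent to \<open>1\<close> modulo \<open>X\<close>, so it cannot vanish at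
  an element of nonnegative valuation.
\<close>

theorem weierstrass_preparation_poly:
  fixes F :: "'a::field fps poly"
  assumes monic: "lead_coeff (reduction F) = 1"
  shows "\<exists>G H. F = G * H \<and> lead_coeff G = 1 \<and> reduction H = 1"
proof -
  define W where "W k = X_coeff k F" for k
  have W0: "W 0 = reduction F" by (simp add: W_def X_coeff_0)
  have F0: "W 0 \<noteq> 0" using monic by (metis W0 leading_coeff_0_iff zero_neq_one)
  have "degree (W k) \<le> degree F" for k
    by (rule degree_le) (simp add: W_def coeff_eq_0)
  note deg = degree_prep_coeffs[of W "degree F", OF this F0]
  obtain G where G: "X_coeff k G = fst (prep_coeffs W k)" for k
    using ex_poly_with_X_coeffs[of "\<lambda>k. fst (prep_coeffs W k)"] deg by blast
  obtain H where H: "X_coeff k H = snd (prep_coeffs W k)" for k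
    using ex_poly_with_X_coeffs[of "\<lambda>k. snd (prep_coeffs W k)"] deg by blast
  have "F = G * H"
    by (rule poly_eq_if_X_coeff_eq)
      (simp add: X_coeff_mult G H prep_coeffs_convolution W_def)
  moreover have "reduction H = 1"
    using H[of 0] by (simp add: X_coeff_0 prep_coeffs_0)
  moreover have "lead_coeff G = 1"
  proof -
    define d where "d = degree (W 0)"
    have top: "coeff G d = 1"
    proof (rule fps_ext)
      fix k
      have "fps_nth (coeff G d) k = coeff (fst (prep_coeffs W k)) d"
        using G[of k] by (metis coeff_X_coeff)
      also have "\<dots> = (if k = 0 then 1 else 0)"
        using deg[of k] monic by (auto simp: prep_coeffs_0 d_def W0 coeff_eq_0)
      finally show "fps_nth (coeff G d) k = fps_nth 1 k" by simp
    qed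
    have "degree G \<le> d"
    proof (rule degree_le, intro allI impI)
      fix i assume "d < i"
      show "coeff G i = 0"
      proof (rule fps_ext)
        fix k
        have "fps_nth (coeff G i) k = coeff (fst (prep_coeffs W k)) i"
          using G[of k] by (metis coeff_X_coeff)
        also have "\<dots> = 0"
          using deg[of k] \<open>d < i\<close> by (intro coeff_eq_0) (auto simp: d_def)
        finally show "fps_nth (coeff G i) k = fps_nth 0 k" by simp
      qed
    qed
    with top show ?thesis
      by (metis le_antisym le_degree one_neq_zero)
  qed
  ultimately show ?thesis by blast
qed

section \<open>Irreducibility over Laurent series\<close>

lemma fls_X_intpow_times_nth: "fls_nth (fls_X_intpow n * F) k = fls_nth (F :: 'a::field fls) (k - n)"
  by (simp add: fls_X_intpow_times_conv_shift)

lemma ex_primitive_part: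
  fixes F :: "'a::field fls poly"
  assumes "F \<noteq> 0"
  shows "\<exists>n A. F = smult (fls_X_intpow n) (to_fls_poly A) \<and> reduction A \<noteq> 0"
proof -
  define I where "I = {i. coeff F i \<noteq> 0}"
  have "I \<subseteq> {..degree F}" by (auto simp: I_def le_degree)
  then have fin: "finite I" by (rule finite_subset) simp
  have "I \<noteq> {}" using assms by (auto simp: I_def poly_eq_iff)
  define n where "n = Min ((\<lambda>i. fls_subdegree (coeff F i)) ` I)"
  have le: "n \<le> fls_subdegree (coeff F i)" if "coeff F i \<noteq> 0" for i
    unfolding n_def using fin that by (intro Min_le) (auto simp: I_def)
  have "n \<in> (\<lambda>i. fls_subdegree (coeff F i)) ` I"
    unfolding n_def using fin \<open>I \<noteq> {}\<close> by (intro Min_in) auto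
  then obtain j where j: "coeff F j \<noteq> 0" "fls_subdegree (coeff F j) = n"
    by (auto simp: I_def)
  define A where "A = map_poly (\<lambda>c. fls_regpart (fls_shift n c)) F"
  have A: "coeff A i = fls_regpart (fls_shift n (coeff F i))" for i
    by (simp add: A_def coeff_map_poly)
  have "F = smult (fls_X_intpow n) (to_fls_poly A)"
  proof (rule poly_eqI, rule fls_eqI)
    fix i k
    have "fls_nth (coeff F i) k = 0" if "k < n"
      using le[of i] that by (cases "coeff F i = 0") auto
    then show "fls_nth (coeff F i) k = fls_nth (coeff (smult (fls_X_intpow n) (to_fls_poly A)) i) k"
      by (auto simp: fls_X_intpow_times_nth A simp del: fls_X_power_int)
  qed
  moreover have "coeff (reduction A) j \<noteq> 0"
    using j by (auto simp: A)
  then have "reduction A \<noteq> 0" by (metis coeff_0)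
  ultimately show ?thesis by blast
qed

text \<open>
  If \<open>n > 0\<close>, then \<open>B\<close> vanishes modulo \<open>X\<close>; if \<open>n < 0\<close>, then \<open>A\<close> does.
\<close>

lemma primitive_scaling_trivial:
  fixes A B :: "'a::field fps poly"
  assumes eq: "smult (fls_X_intpow n) (to_fls_poly A) = to_fls_poly B"
    and A: "reduction A \<noteq> 0" and B: "reduction B \<noteq> 0"
  shows "n = 0"
proof (rule ccontr)
  assume "n \<noteq> 0"
  have c: "fls_nth (fps_to_fls (coeff A i)) (k - n) = fls_nth (fps_to_fls (coeff B i)) k" for i k
    using arg_cong[OF eq, of "\<lambda>P. fls_nth (coeff P i) k"]
    by (simp add: fls_X_intpow_times_nth del: fps_to_fls_nth)
  show False
  proof (cases "n > 0")
    case True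
    then have "coeff (reduction B) i = 0" for i
      using c[of i 0] by simp
    with B show False by (simp add: poly_eq_iff)
  next
    case False
    with \<open>n \<noteq> 0\<close> have "coeff (reduction A) i = 0" for i
      using c[of i n] by simp
    with A show False by (simp add: poly_eq_iff)
  qed
qed

lemma reduction_monic_neq_0:
  assumes "lead_coeff (g :: 'a::field fps poly) = 1"
  shows "reduction g \<noteq> 0"
proof
  assume "reduction g = 0"
  then have "coeff (reduction g) (degree g) = 0" by simp
  with assms show False by simp
qed

text \<open>
  Gauss's lemma.  Given a factorization over Laurent series, each factor is a power of \<open>X\<close> times a
  polynomial over power series that is nonzero modulo \<open>X\<close>.  The product of these two is again nonzero
  modulo \<open>X\<close>, as is the monic \<open>g\<close>, so the powers of \<open>X\<close> cancel and \<open>g\<close> already factors over power series.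
\<close>

lemma prime_elem_to_fls_poly:
  fixes g :: "'a::field fps poly"
  assumes irred: "irreducible g" and monic: "lead_coeff g = 1"
  shows "prime_elem (to_fls_poly g)"
proof (rule field_poly_irreducible_imp_prime, rule irreducibleI)
  have deg: "degree (to_fls_poly g) = degree g"
    by (simp add: degree_map_poly)
  show "to_fls_poly g \<noteq> 0"
    using irred by (metis fps_to_fls_eq_0_iff irreducible_def map_poly_eq_0_iff fps_zero_to_fls)
  have "degree g \<noteq> 0"
  proof
    assume "degree g = 0"
    then have "g = 1" using monic by (auto elim: degree_eq_zeroE simp: one_pCons)
    with irred show False by simp
  qed
  then show "\<not> to_fls_poly g dvd 1"
    using deg \<open>to_fls_poly g \<noteq> 0\<close> by (simp add: is_unit_iff_degree)
  fix P Q assume PQ: "to_fls_poly g = P * Q"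
  with \<open>to_fls_poly g \<noteq> 0\<close> have "P \<noteq> 0" "Q \<noteq> 0" by auto
  obtain a A where A: "P = smult (fls_X_intpow a) (to_fls_poly A)" "reduction A \<noteq> 0"
    using ex_primitive_part[OF \<open>P \<noteq> 0\<close>] by blast
  obtain b B where B: "Q = smult (fls_X_intpow b) (to_fls_poly B)" "reduction B \<noteq> 0"
    using ex_primitive_part[OF \<open>Q \<noteq> 0\<close>] by blast
  have eq: "smult (fls_X_intpow (a + b)) (to_fls_poly (A * B)) = to_fls_poly g"
    unfolding PQ A(1) B(1)
    by (simp add: to_fls_poly_hom.hom_mult mult_smult_left fls_X_intpow_times_fls_X_intpow mult_ac add.commute)
  moreover have "reduction (A * B) \<noteq> 0"
    using A(2) B(2) by (simp add: reduction_hom.hom_mult)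
  ultimately have "a + b = 0"
    using primitive_scaling_trivial reduction_monic_neq_0[OF monic] by blast
  with eq have "to_fls_poly (A * B) = to_fls_poly g" by simp
  then have "A * B = g"
    by (metis coeff_map_poly fps_to_fls_eq_iff fps_zero_to_fls poly_eqI)
  then have "A dvd 1 \<or> B dvd 1"
    using irred by (metis irreducibleD)
  then have "to_fls_poly A dvd 1 \<or> to_fls_poly B dvd 1"
    using to_fls_poly_hom.hom_dvd to_fls_poly_hom.hom_one by metis
  then show "P dvd 1 \<or> Q dvd 1"
    unfolding A(1) B(1) by (simp add: is_unit_smult_iff dvd_field_iff)
qed

section \<open>Annihilating polynomials and inverses in quotients\<close>

lemma pcompose_monom: "pcompose (monom a k) q = smult a (q ^ k)"
  by (simp add: pcompose_altdef map_poly_monom poly_monom)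

text \<open>
  The \<open>deg g + 1\<close> powers \<open>q\<^sup>0, \<dots>, q\<^sup>n\<close> have residues in a space of dimension \<open>n = deg g\<close>, so they are
  linearly dependent modulo \<open>g\<close>.  The dimension bound speaks of sets of vectors, not of families, so
  the case of two equal residues is treated separately.
\<close>

lemma ex_annihilating_poly:
  fixes g q :: "'k::field poly"
  assumes "g \<noteq> 0"
  shows "\<exists>P. P \<noteq> 0 \<and> g dvd pcompose P q"
proof -
  interpret V: vector_space "smult :: 'k \<Rightarrow> 'k poly \<Rightarrow> 'k poly"
    by unfold_locales (simp_all add: smult_add_right smult_add_left)
  define n where "n = degree g"
  define f where "f k = q ^ k mod g" for k
  have f: "g dvd smult a (q ^ k) - smult a (f k)" for a k
    by (metis dvd_smult f_def minus_mod_eq_mult_div dvd_triv_left smult_diff_right)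
  show ?thesis
  proof (cases "n = 0")
    case True
    then have "g dvd 1" using assms by (simp add: n_def is_unit_iff_degree)
    then have "g dvd pcompose 1 q" by (simp add: pcompose_1)
    then show ?thesis by (intro exI[of _ 1]) simp
  next
    case n: False
    show ?thesis
    proof (cases "inj_on f {..n}")
      case False
      then obtain i j where ij: "i \<noteq> j" "f i = f j" by (auto simp: inj_on_def)
      have "pcompose (monom 1 i - monom 1 j) q =
          (smult 1 (q ^ i) - smult 1 (f i)) - (smult 1 (q ^ j) - smult 1 (f j))"
        using ij by (simp add: pcompose_diff pcompose_monom)
      then have "g dvd pcompose (monom 1 i - monom 1 j) q"
        using f dvd_diff by metis
      moreover have "coeff (monom (1::'k) i - monom 1 j) i \<noteq> 0" using ij by simp
      then have "monom (1::'k) i - monom 1 j \<noteq> 0" by force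
      ultimately show ?thesis by blast
    next
      case True
      define T where "T = (\<lambda>i. monom (1::'k) i) ` {..<n}"
      have "f k \<in> V.span T" for k
      proof -
        have "degree (f k) < n"
          using n assms degree_mod_less[of g "q ^ k"] by (auto simp: f_def n_def)
        then have "f k = (\<Sum>i<n. smult (coeff (f k) i) (monom 1 i))"
          by (intro poly_eqI) (auto simp: coeff_sum coeff_eq_0 if_distrib[of "(*) _"] cong: if_cong)
        also have "\<dots> \<in> V.span T"
          by (intro V.span_sum V.span_scale V.span_base) (auto simp: T_def)
        finally show ?thesis .
      qed
      moreover have "card T \<le> n" unfolding T_def by (metis card_image_le card_lessThan finite_lessThan)
      moreover have "card (f ` {..n}) = Suc n" using True by (simp add: card_image)
      ultimately have "V.dependent (f ` {..n})"
        using V.independent_span_bound[of T "f ` {..n}"] by (force simp: T_def)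
      then obtain u where u: "\<exists>v\<in>f ` {..n}. u v \<noteq> 0" "(\<Sum>v\<in>f ` {..n}. smult (u v) v) = 0"
        by (auto simp: V.dependent_finite)
      define P where "P = (\<Sum>k\<le>n. monom (u (f k)) k)"
      have "pcompose P q = (\<Sum>k\<le>n. smult (u (f k)) (q ^ k))"
        by (simp add: P_def pcompose_sum pcompose_monom)
      also have "\<dots> = (\<Sum>k\<le>n. smult (u (f k)) (q ^ k) - smult (u (f k)) (f k))"
        using u(2) True by (simp add: sum_subtractf sum.reindex)
      finally have "g dvd pcompose P q"
        using f by (metis (no_types, lifting) dvd_sum)
      moreover obtain k where k: "k \<le> n" "u (f k) \<noteq> 0" using u(1) by auto
      then have "coeff P k \<noteq> 0" by (simp add: P_def coeff_sum)
      then have "P \<noteq> 0" by auto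
      ultimately show ?thesis by blast
    qed
  qed
qed

text \<open>
  Dividing an annihilating polynomial of \<open>w\<close> by the largest possible power of the variable leaves
  one with constant coefficient \<open>a \<noteq> 0\<close>, that is \<open>a + w * S(w) = 0\<close> modulo \<open>g\<close>.
\<close>

lemma ex_inverse_mod_prime:
  fixes g w :: "'k::field poly"
  assumes prime: "prime_elem g" and w: "\<not> g dvd w"
  shows "\<exists>w'. g dvd w * w' - 1"
proof -
  obtain P where P: "P \<noteq> 0" "g dvd pcompose P w"
    using ex_annihilating_poly[of g w] prime by (auto simp: prime_elem_def)
  obtain R where R: "P = [:- 0, 1:] ^ order 0 P * R" "\<not> [:- 0, 1:] dvd R"
    using order_decomp[OF P(1)] by blast
  have pow: "pcompose ([:- 0, 1:] ^ k) w = w ^ k" for k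
    by (induction k) (simp_all add: pcompose_mult pcompose_1 pcompose_pCons)
  have "pcompose P w = w ^ order 0 P * pcompose R w"
    using pow by (metis R(1) pcompose_mult)
  with P(2) prime w have gR: "g dvd pcompose R w"
    by (metis prime_elem_dvd_multD prime_elem_dvd_power)
  obtain a S where S: "R = pCons a S" by (cases R)
  with R(2) have a: "a \<noteq> 0" by (simp add: dvd_iff_poly_eq_0)
  have "w * (- smult (inverse a) (pcompose S w)) - 1 = smult (- inverse a) (pcompose R w)"
    using a by (simp add: S pcompose_pCons smult_add_right one_pCons algebra_simps)
  then show ?thesis
    using gR by (metis dvd_smult)
qed

section \<open>Gluing integral bases over coprime factors\<close>

lemma prime_elem_dvd_prodD:
  assumes "prime_elem (p :: 'r::algebraic_semidom)" "p dvd prod f I"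
  shows "\<exists>i\<in>I. p dvd f i"
  using assms(2)
proof (induction I rule: infinite_finite_induct)
  case (insert i I)
  then show ?case using prime_elem_dvd_multD[OF assms(1)] by (metis insert_iff prod.insert)
qed (use assms(1) in \<open>auto simp: prime_elem_def\<close>)

lemma prod_dvd_if_primes_dvd:
  fixes G :: "'i \<Rightarrow> 'r::algebraic_semidom"
  assumes "finite I" "\<And>i. i \<in> I \<Longrightarrow> prime_elem (G i)" "\<And>i. i \<in> I \<Longrightarrow> G i dvd q"
    and "\<And>i j. i \<in> I \<Longrightarrow> j \<in> I \<Longrightarrow> i \<noteq> j \<Longrightarrow> \<not> G i dvd G j"
  shows "prod G I dvd q"
  using assms
proof (induction I rule: finite_induct)
  case (insert i I)
  then obtain t where t: "q = prod G I * t" by (auto elim!: dvdE)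
  have "\<not> G i dvd prod G I"
    using prime_elem_dvd_prodD[of "G i" G I] insert.prems insert.hyps by blast
  moreover have "G i dvd prod G I * t" using insert.prems t by auto
  ultimately have "G i dvd t" using insert.prems prime_elem_dvd_multD by blast
  then show ?case using insert.hyps by (simp add: t mult.commute mult_dvd_mono)
qed simp

interpretation map_to_fls_poly_hom:
  unital_ring_hom "map_poly to_fls_poly :: 'a::field fps poly poly \<Rightarrow> 'a fls poly poly"
  by (rule to_fls_poly_hom.unital_ring_hom_map_poly)

text \<open>
  An element that is integral modulo each factor by way of \<open>P i\<close> is integral modulo the product
  by way of the product of the \<open>P i\<close>, because \<open>g i\<close> divides the \<open>i\<close>-th factor of the value.
\<close>

lemma normalization_prod:
  fixes g :: "'i \<Rightarrow> 'a::field fps poly"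
  assumes "finite I"
  shows "normalization (\<Prod>i\<in>I. g i) = (\<Inter>i\<in>I. normalization (g i))"
proof (intro equalityI subsetI)
  fix q assume "q \<in> normalization (\<Prod>i\<in>I. g i)"
  then obtain P where P: "lead_coeff P = 1"
    "to_fls_poly (\<Prod>i\<in>I. g i) dvd poly (map_poly to_fls_poly P) q"
    by (auto simp: normalization_def cong_0_iff)
  have "to_fls_poly (g i) dvd poly (map_poly to_fls_poly P) q" if "i \<in> I" for i
    using dvd_trans[OF to_fls_poly_hom.hom_dvd P(2)] assms that by (metis dvd_prodI)
  then show "q \<in> (\<Inter>i\<in>I. normalization (g i))"
    using P(1) by (auto simp: normalization_def cong_0_iff)
next
  fix q assume "q \<in> (\<Inter>i\<in>I. normalization (g i))"
  then have "\<forall>i\<in>I. \<exists>P. lead_coeff P = 1 \<and> to_fls_poly (g i) dvd poly (map_poly to_fls_poly P) q"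
    by (simp add: normalization_def cong_0_iff)
  then obtain P where P: "\<And>i. i \<in> I \<Longrightarrow> lead_coeff (P i) = 1"
    "\<And>i. i \<in> I \<Longrightarrow> to_fls_poly (g i) dvd poly (map_poly to_fls_poly (P i)) q"
    by metis
  have "lead_coeff (\<Prod>i\<in>I. P i) = 1"
    using P(1) by (simp add: lead_coeff_prod)
  moreover have "to_fls_poly (\<Prod>i\<in>I. g i) dvd poly (map_poly to_fls_poly (\<Prod>i\<in>I. P i)) q"
    unfolding to_fls_poly_hom.hom_prod map_to_fls_poly_hom.hom_prod poly_prod
    using P(2) by (rule prod_dvd_prod)
  ultimately show "q \<in> normalization (\<Prod>i\<in>I. g i)"
    by (auto simp: normalization_def cong_0_iff)
qed

lemma dvd_imp_in_normalization: "to_fls_poly g dvd q \<Longrightarrow> q \<in> normalization g"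
  by (auto simp: normalization_def cong_0_iff map_poly_pCons intro!: exI[of _ "[:0, 1:]"])

lemma integral_basis_not_dvd:
  fixes g :: "'a::field fps poly"
  assumes basis: "represents_integral_basis g S" and s: "s \<in> S"
  shows "\<not> to_fls_poly g dvd s"
proof
  assume dvd: "to_fls_poly g dvd s"
  define a where "a t = (if t = s then 1 else 0 :: 'a fps)" for t
  have "finite S" using basis by (simp add: represents_integral_basis_def)
  have "(\<Sum>t\<in>S. smult (fps_to_fls (a t)) t) = (\<Sum>t\<in>S. if t = s then s else 0)"
    by (rule sum.cong) (auto simp: a_def)
  also have "\<dots> = s" using \<open>finite S\<close> s by simp
  finally have "[(\<Sum>t\<in>S. smult (fps_to_fls (a t)) t) = 0] (mod to_fls_poly g)"
    using dvd by (simp add: cong_0_iff)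
  then have "a s = 0" using basis s by (simp add: represents_integral_basis_def)
  then show False by (simp add: a_def)
qed

text \<open>
  The normalization of the product is the direct product of the normalizations of the factors,
  and \<open>w i\<close> is zero in all components but the \<open>i\<close>-th, where it is a unit.  Multiplication by \<open>w i\<close> thus
  carries a basis of the \<open>i\<close>-th component to a basis of the \<open>i\<close>-th summand.  The existence of such \<open>w\<close>
  also makes the factors pairwise coprime: if \<open>g i\<close> divided another \<open>g j\<close>, it would divide \<open>w i\<close>,
  which is invertible modulo \<open>g i\<close>.
\<close>

theorem represents_integral_basis_prod:
  fixes g :: "'i \<Rightarrow> 'a::field fps poly" and w :: "'i \<Rightarrow> 'a fls poly"
  assumes fin: "finite I"
    and prime: "\<And>i. i \<in> I \<Longrightarrow> prime_elem (to_fls_poly (g i))"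
    and basis: "\<And>i. i \<in> I \<Longrightarrow> represents_integral_basis (g i) (S i)"
    and closed: "\<And>i p q. i \<in> I \<Longrightarrow> p \<in> normalization (g i) \<Longrightarrow> q \<in> normalization (g i) \<Longrightarrow>
      p * q \<in> normalization (g i)"
    and vanish: "\<And>i j. i \<in> I \<Longrightarrow> j \<in> I \<Longrightarrow> i \<noteq> j \<Longrightarrow> to_fls_poly (g j) dvd w i"
    and integral: "\<And>i. i \<in> I \<Longrightarrow> w i \<in> normalization (g i)"
    and inverse: "\<And>i. i \<in> I \<Longrightarrow> \<exists>w'\<in>normalization (g i). to_fls_poly (g i) dvd w i * w' - 1"
  shows "represents_integral_basis (\<Prod>i\<in>I. g i) (\<Union>i\<in>I. (*) (w i) ` S i)"
proof -
  define G where "G i = to_fls_poly (g i)" for i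
  obtain w' where w': "\<And>i. i \<in> I \<Longrightarrow> w' i \<in> normalization (g i)"
    "\<And>i. i \<in> I \<Longrightarrow> G i dvd w i * w' i - 1"
    using inverse unfolding G_def by metis
  have finS: "finite (S i)" if "i \<in> I" for i
    using basis[OF that] by (simp add: represents_integral_basis_def)
  have cancel: "G i dvd q" if i: "i \<in> I" and "G i dvd w i * q" for i q
  proof -
    have "q = w' i * (w i * q) - q * (w i * w' i - 1)" by (simp add: algebra_simps)
    moreover have "G i dvd w' i * (w i * q) - q * (w i * w' i - 1)"
      by (rule dvd_diff[OF dvd_mult[OF that(2)] dvd_mult[OF w'(2)[OF i]]])
    ultimately show ?thesis by simp
  qed
  have not_unit: "\<not> G i dvd 1" if "i \<in> I" for i
    using prime[OF that] by (simp add: G_def prime_elem_def)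
  have not_dvd: "\<not> G i dvd G j" if "i \<in> I" "j \<in> I" "i \<noteq> j" for i j
  proof
    assume "G i dvd G j"
    then have "G i dvd w i * 1" using vanish[OF that] dvd_trans by (simp add: G_def) blast
    then show False using cancel not_unit that(1) by blast
  qed
  have prod_dvd: "to_fls_poly (\<Prod>i\<in>I. g i) dvd q \<longleftrightarrow> (\<forall>i\<in>I. G i dvd q)" for q
  proof
    assume "\<forall>i\<in>I. G i dvd q"
    then have "prod G I dvd q"
      using fin prime not_dvd by (intro prod_dvd_if_primes_dvd) (auto simp: G_def)
    then show "to_fls_poly (\<Prod>i\<in>I. g i) dvd q"
      by (simp add: to_fls_poly_hom.hom_prod G_def)
  next
    assume "to_fls_poly (\<Prod>i\<in>I. g i) dvd q"
    then show "\<forall>i\<in>I. G i dvd q"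
      using fin unfolding to_fls_poly_hom.hom_prod G_def by (metis dvd_prodI dvd_trans)
  qed
  define f where "f = (\<lambda>(i, s). w i * s)"
  have T: "(\<Union>i\<in>I. (*) (w i) ` S i) = f ` Sigma I S"
    by (auto simp: f_def)
  have inj: "inj_on f (Sigma I S)"
  proof (rule inj_onI, clarify)
    fix i s j t assume ij: "i \<in> I" "s \<in> S i" "j \<in> I" "t \<in> S j" and "f (i, s) = f (j, t)"
    then have eq: "w i * s = w j * t" by (simp add: f_def)
    have "i = j"
    proof (rule ccontr)
      assume "i \<noteq> j"
      then have "G i dvd w i * s" unfolding eq using vanish[of j i] ij by (simp add: G_def)
      then have "G i dvd s" using cancel ij(1) by blast
      then show False using integral_basis_not_dvd[OF basis[OF ij(1)] ij(2)] by (simp add: G_def)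
    qed
    moreover have "w i \<noteq> 0" 
      using cancel[of i 1] not_unit[of i] ij(1) by (metis dvd_0_right mult_zero_left)
    ultimately show "i = j \<and> s = t" using eq by simp
  qed
  have sum_T: "(\<Sum>t\<in>f ` Sigma I S. smult (fps_to_fls (b t)) t) =
      (\<Sum>i\<in>I. w i * (\<Sum>s\<in>S i. smult (fps_to_fls (b (w i * s))) s))" for b
  proof -
    have "(\<Sum>t\<in>f ` Sigma I S. smult (fps_to_fls (b t)) t) =
        (\<Sum>p\<in>Sigma I S. smult (fps_to_fls (b (f p))) (f p))"
      using inj by (simp add: sum.reindex)
    also have "\<dots> = (\<Sum>i\<in>I. \<Sum>s\<in>S i. smult (fps_to_fls (b (w i * s))) (w i * s))"
      using fin finS by (subst sum.Sigma) (auto simp: f_def split_def)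
    finally show ?thesis by (simp add: sum_distrib_left)
  qed
  have sum_mod: "G i dvd (\<Sum>j\<in>I. w j * r j) - w i * r i" if "i \<in> I" for i r
  proof -
    have "(\<Sum>j\<in>I. w j * r j) - w i * r i = (\<Sum>j\<in>I - {i}. w j * r j)"
      using fin that by (simp add: sum.remove)
    then show ?thesis
      unfolding G_def using vanish that by (auto intro!: dvd_sum dvd_mult2)
  qed
  show ?thesis
    unfolding represents_integral_basis_def T
  proof (intro conjI ballI allI impI subsetI)
    show "finite (f ` Sigma I S)" using fin finS by auto
  next
    fix t assume "t \<in> f ` Sigma I S"
    then obtain i s where t: "i \<in> I" "s \<in> S i" "t = w i * s" by (auto simp: f_def)
    have "t \<in> normalization (g j)" if "j \<in> I" for j
    proof (cases "j = i")
      case True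
      have "s \<in> normalization (g i)"
        using basis[OF t(1)] t(2) by (auto simp: represents_integral_basis_def)
      then show ?thesis using True t closed integral by simp
    qed (use that t vanish[of i j] in \<open>auto intro!: dvd_imp_in_normalization\<close>)
    then show "t \<in> normalization (\<Prod>i\<in>I. g i)" using fin by (simp add: normalization_prod)
  next
    fix q assume "q \<in> normalization (\<Prod>i\<in>I. g i)"
    then have q: "w' i * q \<in> normalization (g i)" if "i \<in> I" for i
      using that fin w'(1) closed by (simp add: normalization_prod)
    have "\<exists>a. G i dvd w' i * q - (\<Sum>s\<in>S i. smult (fps_to_fls (a s)) s)" if "i \<in> I" for i
      using basis[OF that] q[OF that]
      by (auto simp: represents_integral_basis_def cong_iff_dvd_diff G_def)
    then obtain a where a: "\<And>i. i \<in> I \<Longrightarrow>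
        G i dvd w' i * q - (\<Sum>s\<in>S i. smult (fps_to_fls (a i s)) s)"
      by metis
    define b where "b t = (case the_inv_into (Sigma I S) f t of (i, s) \<Rightarrow> a i s)" for t
    have b: "b (w i * s) = a i s" if "i \<in> I" "s \<in> S i" for i s
      using the_inv_into_f_f[OF inj, of "(i, s)"] that by (simp add: b_def f_def)
    define r where "r i = (\<Sum>s\<in>S i. smult (fps_to_fls (a i s)) s)" for i
    have total: "(\<Sum>t\<in>f ` Sigma I S. smult (fps_to_fls (b t)) t) = (\<Sum>i\<in>I. w i * r i)"
      unfolding sum_T r_def by (intro sum.cong arg_cong2[of _ _ _ _ "(*)"] refl) (simp add: b)
    have "G i dvd q - (\<Sum>i\<in>I. w i * r i)" if i: "i \<in> I" for i
    proof -
      \<comment> \<open>The three parts vanish modulo \<open>G i\<close> by the local expansion, by invertibility of \<open>w i\<close>, and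
        because the other \<open>w j\<close> vanish there.\<close>
      have "q - (\<Sum>i\<in>I. w i * r i) =
          w i * (w' i * q - r i) - q * (w i * w' i - 1) - ((\<Sum>i\<in>I. w i * r i) - w i * r i)"
        by (simp add: algebra_simps)
      moreover have "G i dvd \<dots>"
        by (rule dvd_diff[OF dvd_diff[OF dvd_mult[OF a[OF i, folded r_def]]
              dvd_mult[OF w'(2)[OF i]]] sum_mod[OF i]])
      ultimately show ?thesis by (simp only:)
    qed
    then show "\<exists>b. [q = (\<Sum>t\<in>f ` Sigma I S. smult (fps_to_fls (b t)) t)] (mod to_fls_poly (\<Prod>i\<in>I. g i))"
      unfolding cong_iff_dvd_diff prod_dvd by (intro exI[of _ b]) (simp add: total)
  next
    fix b :: "'a fls poly \<Rightarrow> 'a fps" and t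
    assume zero: "[(\<Sum>t\<in>f ` Sigma I S. smult (fps_to_fls (b t)) t) = 0] (mod to_fls_poly (\<Prod>i\<in>I. g i))"
      and "t \<in> f ` Sigma I S"
    then obtain i s where t: "i \<in> I" "s \<in> S i" "t = w i * s" by (auto simp: f_def)
    define r where "r i = (\<Sum>s\<in>S i. smult (fps_to_fls (b (w i * s))) s)" for i
    have "G i dvd (\<Sum>i\<in>I. w i * r i)"
      using zero t(1) unfolding cong_0_iff prod_dvd sum_T r_def by blast
    then have "G i dvd (\<Sum>i\<in>I. w i * r i) - ((\<Sum>i\<in>I. w i * r i) - w i * r i)"
      using sum_mod[OF t(1), of r] by (rule dvd_diff)
    then have "G i dvd w i * r i" by simp
    then have "G i dvd r i" using cancel t(1) by blast
    then have "[(\<Sum>s\<in>S i. smult (fps_to_fls (b (w i * s))) s) = 0] (mod to_fls_poly (g i))"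
      by (simp add: cong_0_iff r_def G_def)
    moreover have "\<forall>a :: 'a fls poly \<Rightarrow> 'a fps.
        [(\<Sum>s\<in>S i. smult (fps_to_fls (a s)) s) = 0] (mod to_fls_poly (g i)) \<longrightarrow> (\<forall>s\<in>S i. a s = 0)"
      using basis[OF t(1)] unfolding represents_integral_basis_def by (elim conjE)
    ultimately have "\<forall>s\<in>S i. b (w i * s) = 0"
      using spec[where x = "\<lambda>s. b (w i * s)"] by blast
    then show "b t = 0" using t by blast
  qed
qed

section \<open>The normalization as a valuation ring\<close>

text \<open>
  An extension of the field of Laurent series with a valuation ring \<open>V\<close> and its maximal ideal \<open>M\<close>
  that lie over the power series and the power series without constant term.  Only the signs of
  valuations matter below, so the value group does not appear.
\<close>

locale valued_laurent_extension = unital_ring_hom \<phi>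
  for \<phi> :: "'a::field fls \<Rightarrow> 'c::field" +
  fixes V M :: "'c set"
  assumes V_add: "x \<in> V \<Longrightarrow> y \<in> V \<Longrightarrow> x + y \<in> V"
    and V_mult: "x \<in> V \<Longrightarrow> y \<in> V \<Longrightarrow> x * y \<in> V"
    and M_add: "x \<in> M \<Longrightarrow> y \<in> M \<Longrightarrow> x + y \<in> M"
    and V_M_mult: "x \<in> V \<Longrightarrow> y \<in> M \<Longrightarrow> x * y \<in> M"
    and inverse_in_M: "x \<notin> V \<Longrightarrow> inverse x \<in> M"
    and one_notin_M: "1 \<notin> M"
    and M_subset_V: "M \<subseteq> V"
    and fps_in_V: "\<phi> (fps_to_fls F) \<in> V"
    and fps_in_M: "fps_nth F 0 = 0 \<Longrightarrow> \<phi> (fps_to_fls F) \<in> M"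
begin

lemma zero_in_M: "0 \<in> M"
  using fps_in_M[of 0] by (simp add: hom_zero)

lemma minus_one_in_V: "- 1 \<in> V"
  using fps_in_V[of "- 1"] by (simp add: hom_uminus hom_one)

lemma poly_in_V:
  assumes "\<And>i. coeff P i \<in> V" and "x \<in> V"
  shows "poly P x \<in> V"
  using assms(1)
proof (induction P)
  case 0
  then show ?case using zero_in_M M_subset_V by auto
next
  case (pCons a P)
  have "a \<in> V" using pCons.prems[of 0] by simp
  moreover have "coeff P i \<in> V" for i using pCons.prems[of "Suc i"] by simp
  ultimately show ?case
    using pCons.IH assms(2) by (simp add: V_add V_mult)
qed

lemma poly_in_M:
  assumes "\<And>i. coeff P i \<in> M" and "x \<in> V"
  shows "poly P x \<in> M"
  using assms(1)
proof (induction P)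
  case 0
  then show ?case using zero_in_M by simp
next
  case (pCons a P)
  have "a \<in> M" using pCons.prems[of 0] by simp
  moreover have "coeff P i \<in> M" for i using pCons.prems[of "Suc i"] by simp
  ultimately show ?case
    using pCons.IH assms(2) by (simp add: M_add V_M_mult)
qed

text \<open>
  Valuation rings are integrally closed: if \<open>x\<close> lies outside \<open>V\<close>, then \<open>inverse x\<close> lies in \<open>M\<close>, and
  dividing the equation by the top power of \<open>x\<close> writes \<open>1\<close> as an element of \<open>M\<close>.  The reflected
  polynomial is the result of this division.
\<close>

lemma root_of_monic_in_V:
  assumes V: "\<And>i. coeff P i \<in> V" and monic: "lead_coeff P = 1" and root: "poly P x = 0"
  shows "x \<in> V"
proof (rule ccontr)
  assume x: "x \<notin> V"
  then have inv: "inverse x \<in> M" by (rule inverse_in_M)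
  have "x \<noteq> 0" using x zero_in_M M_subset_V by auto
  then have "poly (reflect_poly P) (inverse x) = 0"
    using root by (simp add: poly_reflect_poly_nz)
  moreover obtain a R where R: "reflect_poly P = pCons a R" by (cases "reflect_poly P")
  moreover have "a = 1" using R monic coeff_0_reflect_poly[of P] by simp
  ultimately have "1 = (- 1 * poly R (inverse x)) * inverse x"
    by (simp add: eq_neg_iff_add_eq_0 mult.commute)
  moreover have "coeff R i \<in> V" for i
  proof -
    have "coeff R i = coeff (reflect_poly P) (Suc i)" by (simp add: R)
    also have "\<dots> \<in> V"
      using V zero_in_M M_subset_V by (auto simp: coeff_reflect_poly)
    finally show ?thesis .
  qed
  then have "poly R (inverse x) \<in> V" using inv M_subset_V by (intro poly_in_V) auto
  then have "(- 1 * poly R (inverse x)) * inverse x \<in> M"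
    by (intro V_M_mult V_mult minus_one_in_V inv)
  ultimately show False using one_notin_M by simp
qed

definition ev :: "'c \<Rightarrow> 'a fls poly \<Rightarrow> 'c" where
  "ev \<gamma> q = poly (map_poly \<phi> q) \<gamma>"

lemma unital_ring_hom_ev: "unital_ring_hom (ev \<gamma>)"
proof -
  interpret m: unital_ring_hom "map_poly \<phi>" by (rule unital_ring_hom_map_poly)
  show ?thesis
    by unfold_locales (simp_all add: ev_def m.hom_add m.hom_mult m.hom_one)
qed

sublocale ev: unital_ring_hom "ev \<gamma>" for \<gamma>
  by (rule unital_ring_hom_ev)

lemma ev_pcompose: "ev \<gamma> (pcompose P q) = ev (ev \<gamma> q) P"
  by (simp add: ev_def map_poly_hom_pcompose poly_pcompose)

lemma ev_to_fls_poly_in_V: "\<gamma> \<in> V \<Longrightarrow> ev \<gamma> (to_fls_poly P) \<in> V"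
  unfolding ev_def by (rule poly_in_V) (simp_all add: fps_in_V)

lemma ev_dvd_0: "g dvd q \<Longrightarrow> ev \<gamma> g = 0 \<Longrightarrow> ev \<gamma> q = 0"
  by (auto simp: dvd_def ev.hom_mult)

text \<open>
  Integral closedness of \<open>V\<close> enters twice: the root \<open>\<gamma>\<close> of the monic \<open>g\<close> lies in \<open>V\<close>, hence so does the value
  at \<open>\<gamma>\<close> of every coefficient of the integral equation of \<open>q\<close>, and therefore \<open>q(\<gamma>)\<close>.
\<close>

lemma normalization_imp_in_V:
  assumes monic: "lead_coeff g = 1" and root: "ev \<gamma> (to_fls_poly g) = 0" and q: "q \<in> normalization g"
  shows "ev \<gamma> q \<in> V"
proof -
  have \<gamma>: "\<gamma> \<in> V"
  proof (rule root_of_monic_in_V)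
    show "poly (map_poly \<phi> (to_fls_poly g)) \<gamma> = 0" using root by (simp add: ev_def)
    show "lead_coeff (map_poly \<phi> (to_fls_poly g)) = 1"
    proof -
      have "degree (to_fls_poly g) = degree g" by (simp add: degree_map_poly)
      moreover have "degree (map_poly \<phi> (to_fls_poly g)) = degree (to_fls_poly g)"
        using monic by (intro map_poly_degree_eq) (simp add: hom_one calculation)
      ultimately show ?thesis using monic by (simp add: hom_one)
    qed
  qed (simp add: fps_in_V)
  obtain P where P: "lead_coeff P = 1" "to_fls_poly g dvd poly (map_poly to_fls_poly P) q"
    using q by (auto simp: normalization_def cong_0_iff)
  let ?P = "map_poly (\<lambda>c. ev \<gamma> (to_fls_poly c)) P"
  interpret e: unital_ring_hom "\<lambda>c. ev \<gamma> (to_fls_poly c)"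
    by unfold_locales (simp_all add: ev.hom_add ev.hom_mult ev.hom_one to_fls_poly_hom.hom_add
        to_fls_poly_hom.hom_mult to_fls_poly_hom.hom_one)
  show ?thesis
  proof (rule root_of_monic_in_V)
    have "degree ?P = degree P"
      using P(1) by (intro map_poly_degree_eq) (simp add: ev.hom_one)
    then show "lead_coeff ?P = 1" using P(1) by (simp add: ev.hom_one)
    have "map_poly (ev \<gamma>) (map_poly to_fls_poly P) = ?P"
      by (rule poly_eqI) simp
    then show "poly ?P (ev \<gamma> q) = 0"
      using ev_dvd_0[OF P(2) root] by (simp add: ev.hom_poly)
  qed (use \<gamma> in \<open>simp add: ev_to_fls_poly_in_V\<close>)
qed

text \<open>
  Scale an annihilating polynomial of \<open>q\<close> to be nonzero modulo \<open>X\<close> and split it by Weierstrass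
  preparation into a monic \<open>G\<close> and an \<open>H\<close> that is congruent to \<open>1\<close> modulo \<open>X\<close>.  Since \<open>g\<close> is prime, it
  divides \<open>G(q)\<close> or \<open>H(q)\<close>.  The latter would give \<open>H(q(\<gamma>)) = 0\<close>, which is impossible because
  \<open>q(\<gamma>)\<close> lies in \<open>V\<close>.  So \<open>G(q)\<close> vanishes modulo \<open>g\<close>, and \<open>q\<close> is even integral over the power series.
\<close>

lemma in_V_imp_normalization:
  assumes prime: "prime_elem (to_fls_poly g)" and root: "ev \<gamma> (to_fls_poly g) = 0"
    and q: "ev \<gamma> q \<in> V"
  shows "q \<in> normalization g"
proof -
  let ?g = "to_fls_poly g"
  obtain P where P: "P \<noteq> 0" "?g dvd pcompose P q"
    using ex_annihilating_poly[of ?g q] prime by (auto simp: prime_elem_def)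
  obtain n F where F: "P = smult (fls_X_intpow n) (to_fls_poly F)" "reduction F \<noteq> 0"
    using ex_primitive_part[OF P(1)] by blast
  \<comment> \<open>Rescaled by a constant, the residue becomes monic, as Weierstrass preparation requires.\<close>
  define a where "a = lead_coeff (reduction F)"
  have a: "a \<noteq> 0" using F(2) unfolding a_def by (metis leading_coeff_0_iff)
  define F' where "F' = smult (fps_const (inverse a)) F"
  have "reduction F' = smult (inverse a) (reduction F)"
    by (simp add: F'_def const_coeff_hom.map_poly_hom_smult)
  then have "lead_coeff (reduction F') = 1"
    using a by (simp add: a_def)
  then obtain G H where GH: "F' = G * H" "lead_coeff G = 1" "reduction H = 1"
    using weierstrass_preparation_poly by blast
  have "pcompose P q = smult (fls_X_intpow n) (pcompose (to_fls_poly F) q)"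
    by (simp add: F(1) pcompose_smult)
  then have "?g dvd pcompose (to_fls_poly F) q"
    using P(2) by (simp add: dvd_smult_iff)
  then have "?g dvd pcompose (to_fls_poly F') q"
    by (simp add: F'_def fps_to_fls_hom.map_poly_hom_smult pcompose_smult dvd_smult)
  then have "?g dvd pcompose (to_fls_poly G) q * pcompose (to_fls_poly H) q"
    by (simp add: GH(1) to_fls_poly_hom.hom_mult pcompose_mult)
  moreover have "\<not> ?g dvd pcompose (to_fls_poly H) q"
  proof
    assume "?g dvd pcompose (to_fls_poly H) q"
    then have zero: "ev (ev \<gamma> q) (to_fls_poly H) = 0"
      using ev_dvd_0 root ev_pcompose by metis
    define N where "N = 1 - H"
    have N: "fps_nth (coeff N i) 0 = 0" for i
      using arg_cong[OF GH(3), of "\<lambda>p. coeff p i"] by (simp add: N_def)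
    have "ev (ev \<gamma> q) (to_fls_poly N) \<in> M"
      unfolding ev_def[of "ev \<gamma> q"] using q N by (intro poly_in_M) (simp_all add: fps_in_M)
    moreover have "ev (ev \<gamma> q) (to_fls_poly N) = 1"
      using zero by (simp add: N_def to_fls_poly_hom.hom_diff to_fls_poly_hom.hom_one
          ev.hom_diff ev.hom_one)
    ultimately show False using one_notin_M by simp
  qed
  ultimately have G: "?g dvd pcompose (to_fls_poly G) q"
    using prime prime_elem_dvd_multD by blast
  \<comment> \<open>The coefficients of an integral equation lie in \<open>K[[x]][y]\<close>; those of \<open>G\<close> enter as constants in \<open>y\<close>.\<close>
  define Q where "Q = map_poly (\<lambda>c. [:c:]) G"
  have "degree Q = degree G" unfolding Q_def by (simp add: degree_map_poly)
  then have "lead_coeff Q = 1" using GH(2) by (simp add: Q_def coeff_map_poly one_pCons)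
  moreover have "map_poly to_fls_poly Q = map_poly (\<lambda>c. [:c:]) (to_fls_poly G)"
    unfolding Q_def by (rule poly_eqI) (simp add: coeff_map_poly map_poly_pCons)
  then have "poly (map_poly to_fls_poly Q) q = pcompose (to_fls_poly G) q"
    by (simp add: pcompose_altdef)
  ultimately show ?thesis
    using G by (auto simp: normalization_def cong_0_iff)
qed

text \<open>
  A single root \<open>\<gamma>\<close> decides integrality; in particular it does not matter which of the
  conjugate roots is taken.
\<close>

theorem normalization_iff:
  assumes "irreducible g" "lead_coeff g = 1" "ev \<gamma> (to_fls_poly g) = 0"
  shows "q \<in> normalization g \<longleftrightarrow> ev \<gamma> q \<in> V"
  using normalization_imp_in_V in_V_imp_normalization prime_elem_to_fls_poly assms by blast

lemma normalization_mult:
  assumes "irreducible g" "lead_coeff g = 1" "ev \<gamma> (to_fls_poly g) = 0"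
    and "p \<in> normalization g" "q \<in> normalization g"
  shows "p * q \<in> normalization g"
  using assms by (simp add: normalization_iff[of g \<gamma>] ev.hom_mult V_mult)

lemma ex_inverse_in_normalization:
  assumes g: "irreducible g" "lead_coeff g = 1" "ev \<gamma> (to_fls_poly g) = 0"
    and w: "ev \<gamma> w \<noteq> 0" "inverse (ev \<gamma> w) \<in> V"
  shows "\<exists>w'\<in>normalization g. to_fls_poly g dvd w * w' - 1"
proof -
  have "\<not> to_fls_poly g dvd w" using w(1) g(3) ev_dvd_0 by blast
  then obtain w' where w': "to_fls_poly g dvd w * w' - 1"
    using ex_inverse_mod_prime prime_elem_to_fls_poly g by blast
  then have "ev \<gamma> w * ev \<gamma> w' = 1"
    using ev_dvd_0[OF w' g(3)] by (simp add: ev.hom_diff ev.hom_mult ev.hom_one)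
  then have "ev \<gamma> w' = inverse (ev \<gamma> w)" by (metis inverse_unique)
  then show ?thesis using w' w(2) g by (auto simp: normalization_iff[of g \<gamma>])
qed

end

section \<open>The valuation on Puiseux series\<close>

lemma puiseux_rel_refl: "k > 0 \<Longrightarrow> puiseux_rel (k, F) (k, F)"
  by (simp add: puiseux_rel_def)

lemma puiseux_of_fls_add: "puiseux_of_fls (F + G) = puiseux_of_fls F + puiseux_of_fls G"
  by (simp add: puiseux_of_fls_def plus_puiseux.abs_eq puiseux_rel_refl fls_compose_power_by_1)

lemma puiseux_of_fls_mult: "puiseux_of_fls (F * G) = puiseux_of_fls F * puiseux_of_fls G"
  by (simp add: puiseux_of_fls_def times_puiseux.abs_eq puiseux_rel_refl fls_compose_power_by_1)

lemma puiseux_of_fls_1: "puiseux_of_fls 1 = 1"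
  by (simp add: puiseux_of_fls_def one_puiseux_def)

lemma puiseux_val_of_fls:
  "puiseux_val (puiseux_of_fls F) = (if F = 0 then \<infinity> else ereal (of_int (fls_subdegree F)))"
  by (simp add: puiseux_of_fls_def puiseux_val.abs_eq puiseux_rel_refl)

lemma puiseux_val_eq_PInf_iff: "puiseux_val x = \<infinity> \<longleftrightarrow> x = 0"
  by transfer (auto simp: puiseux_rel_def fls_compose_power_by_1 fls_compose_power_eq_0_iff split: if_splits)

lemma puiseux_val_mult: "puiseux_val (x * y) = puiseux_val x + puiseux_val y"
  by transfer (auto simp: puiseux_rel_def fls_compose_power_eq_0_iff fls_subdegree_compose_power field_simps)

lemma puiseux_val_add: "min (puiseux_val x) (puiseux_val y) \<le> puiseux_val (x + y)"
proof (transfer, goal_cases)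
  case (1 x y)
  obtain k F l G where xy: "x = (k, F)" "y = (l, G)" by (cases x, cases y)
  have pos: "k > 0" "l > 0" using 1 by (auto simp: xy puiseux_rel_def)
  let ?F = "fls_compose_power F l" and ?G = "fls_compose_power G k"
  have zero: "?F = 0 \<longleftrightarrow> F = 0" "?G = 0 \<longleftrightarrow> G = 0"
    using pos by (simp_all add: fls_compose_power_eq_0_iff)
  have sub: "of_int (fls_subdegree F) / real k = of_int (fls_subdegree ?F) / real (k * l)"
    "of_int (fls_subdegree G) / real l = of_int (fls_subdegree ?G) / real (k * l)"
    using pos by (simp_all add: fls_subdegree_compose_power)
  show ?case
  proof (cases "F = 0 \<or> G = 0 \<or> ?F + ?G = 0")
    case True
    then show ?thesis by (auto simp: xy zero sub)
  next
    case False
    then have "min (fls_subdegree ?F) (fls_subdegree ?G) \<le> fls_subdegree (?F + ?G)"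
      by (intro fls_plus_subdegree) auto
    then have "real_of_int (fls_subdegree ?F) / real (k * l) \<le> of_int (fls_subdegree (?F + ?G)) / real (k * l) \<or>
        real_of_int (fls_subdegree ?G) / real (k * l) \<le> of_int (fls_subdegree (?F + ?G)) / real (k * l)"
      unfolding min_le_iff_disj by (elim disjE) (simp_all add: divide_right_mono del: of_nat_mult)
    then show ?thesis
      using False by (simp add: xy sub min_le_iff_disj del: of_nat_mult)
  qed
qed

lemma puiseux_val_inverse:
  assumes "x \<noteq> 0"
  shows "puiseux_val (inverse x) = - puiseux_val x"
proof -
  have "puiseux_val x + puiseux_val (inverse x) = 0"
    using assms puiseux_val_of_fls[of "1 :: 'a fls"]
    by (simp add: puiseux_of_fls_1 zero_ereal_def flip: puiseux_val_mult)
  then show ?thesis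
    by (cases rule: ereal2_cases[of "puiseux_val x" "puiseux_val (inverse x)"]) (auto simp: zero_ereal_def)
qed

definition map_fls :: "('a::zero \<Rightarrow> 'b::zero) \<Rightarrow> 'a fls \<Rightarrow> 'b fls" where
  "map_fls h F = Abs_fls (\<lambda>n. h (fls_nth F n))"

text \<open>
  The product formula with summation bounds that need not be the exact subdegrees, so that it can
  be used with the same bounds for a series and for its image under a coefficient map.
\<close>

lemma fls_times_nth_lower_bounds:
  fixes F G :: "'a::comm_ring_1 fls"
  assumes "a \<le> fls_subdegree F" "b \<le> fls_subdegree G"
  shows "fls_nth (F * G) n = (\<Sum>i=a..n - b. fls_nth F i * fls_nth G (n - i))"
proof -
  have "(\<Sum>i=a..n - b. fls_nth F i * fls_nth G (n - i)) =
      (\<Sum>i=fls_subdegree F..n - fls_subdegree G. fls_nth F i * fls_nth G (n - i))"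
    using assms by (intro sum.mono_neutral_right) (auto simp: not_le)
  then show ?thesis by (simp add: fls_times_nth(2))
qed

context unital_ring_hom
begin

lemma map_fls_nth [simp]: "fls_nth (map_fls h F) n = h (fls_nth F n)"
  unfolding map_fls_def by (rule nth_Abs_fls_lower_bound[of "fls_subdegree F"]) (simp add: hom_zero)

lemma unital_ring_hom_map_fls: "unital_ring_hom (map_fls h)"
proof
  show "map_fls h (F + G) = map_fls h F + map_fls h G" for F G
    by (rule fls_eqI) (simp add: map_fls_nth hom_add)
  show "map_fls h 1 = 1"
    by (rule fls_eqI) (simp add: map_fls_nth hom_one hom_zero)
  fix F G
  define a where "a = min (fls_subdegree F) (fls_subdegree (map_fls h F))"
  define b where "b = min (fls_subdegree G) (fls_subdegree (map_fls h G))"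
  show "map_fls h (F * G) = map_fls h F * map_fls h G"
    by (rule fls_eqI)
      (simp add: fls_times_nth_lower_bounds[of a _ b] a_def b_def map_fls_nth hom_sum hom_mult)
qed

end

section \<open>Integral bases for products of Weierstrass polynomials\<close>

lemma fls_X_powi_eq: "1 / fls_X powi n = (fls_X_intpow (- n) :: 'a::field fls)"
proof -
  have "fls_X_intpow (- n) * (fls_X powi n :: 'a fls) = 1"
    by (simp only: fls_X_power_int fls_X_intpow_times_fls_X_intpow) simp
  then show ?thesis by (metis inverse_eq_divide inverse_unique mult.commute)
qed

lemma over_X_power_mult:
  "over_X_power (p * q) (m + n) = over_X_power p m * over_X_power (q :: 'a::field fps poly) n"
proof -
  have "(fls_X_intpow (- (m + n)) :: 'a fls) = fls_X_intpow (- m) * fls_X_intpow (- n)"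
    by (subst fls_X_intpow_times_fls_X_intpow) simp
  then show ?thesis
    unfolding over_X_power_def fls_X_powi_eq
    by (simp only: to_fls_poly_hom.hom_mult mult_smult_left mult_smult_right smult_smult mult.commute)
qed

lemma valued_laurent_extension_puiseux:
  fixes \<iota> :: "'a::field \<Rightarrow> 'b::field"
  assumes "unital_ring_hom \<iota>"
  shows "valued_laurent_extension (\<lambda>F. puiseux_of_fls (map_fls \<iota> F))
    {x. puiseux_val x \<ge> 0} {x. puiseux_val x > 0}"
proof -
  interpret \<iota>: unital_ring_hom \<iota> by fact
  interpret m: unital_ring_hom "map_fls \<iota>" by (rule \<iota>.unital_ring_hom_map_fls)
  have val_fps: "ereal (of_int n) \<le> puiseux_val (puiseux_of_fls (map_fls \<iota> (fps_to_fls F)))"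
    if "\<And>k. int k < n \<Longrightarrow> fps_nth F k = 0" for F n
  proof -
    have "n \<le> fls_subdegree (map_fls \<iota> (fps_to_fls F))" if "map_fls \<iota> (fps_to_fls F) \<noteq> 0"
      using that \<open>\<And>k. int k < n \<Longrightarrow> fps_nth F k = 0\<close>
      by (intro fls_subdegree_geI) (auto simp: \<iota>.hom_zero)
    then show ?thesis by (simp add: puiseux_val_of_fls)
  qed
  show ?thesis
  proof
    fix x y :: "'b puiseux"
    show "x + y \<in> {x. 0 \<le> puiseux_val x}" if "x \<in> {x. 0 \<le> puiseux_val x}" "y \<in> {x. 0 \<le> puiseux_val x}"
      using that puiseux_val_add[of x y] by (auto simp: min_def split: if_splits)
    show "x + y \<in> {x. 0 < puiseux_val x}" if "x \<in> {x. 0 < puiseux_val x}" "y \<in> {x. 0 < puiseux_val x}"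
      using that puiseux_val_add[of x y] by (auto simp: min_def split: if_splits)
    show "x * y \<in> {x. 0 \<le> puiseux_val x}" if "x \<in> {x. 0 \<le> puiseux_val x}" "y \<in> {x. 0 \<le> puiseux_val x}"
      using that by (simp add: puiseux_val_mult)
    show "x * y \<in> {x. 0 < puiseux_val x}" if "x \<in> {x. 0 \<le> puiseux_val x}" "y \<in> {x. 0 < puiseux_val x}"
      using that by (simp add: puiseux_val_mult add_nonneg_pos)
    show "inverse x \<in> {x. 0 < puiseux_val x}" if "x \<notin> {x. 0 \<le> puiseux_val x}"
    proof -
      have "x \<noteq> 0" using that puiseux_val_eq_PInf_iff[of x] by auto
      then show ?thesis using that by (simp add: puiseux_val_inverse ereal_uminus_less_reorder not_le)
    qed
    show "1 \<notin> {x :: 'b puiseux. 0 < puiseux_val x}"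
      using puiseux_val_of_fls[of "1 :: 'b fls"] by (simp add: puiseux_of_fls_1)
  next
    fix F :: "'a fps"
    show "puiseux_of_fls (map_fls \<iota> (fps_to_fls F)) \<in> {x. 0 \<le> puiseux_val x}"
      using val_fps[of 0 F] by (simp add: zero_ereal_def)
    show "puiseux_of_fls (map_fls \<iota> (fps_to_fls F)) \<in> {x. 0 < puiseux_val x}" if "fps_nth F 0 = 0"
      using val_fps[of 1 F] that by (auto intro: less_le_trans[of 0 "ereal 1"])
  qed (auto simp: m.hom_add m.hom_mult m.hom_one puiseux_of_fls_add puiseux_of_fls_mult puiseux_of_fls_1)
qed

text \<open>
  An infimum over no roots is \<open>\<infinity>\<close>, so a finite value also supplies a root.
\<close>

lemma val_along_attained:
  assumes "g \<noteq> 0" "val_along g q \<noteq> \<infinity>"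
  shows "\<exists>\<gamma>. poly g \<gamma> = 0 \<and> puiseux_val (poly q \<gamma>) = val_along g q"
proof -
  let ?R = "{\<gamma>. poly g \<gamma> = 0}"
  have "?R \<noteq> {}"
  proof
    assume "?R = {}"
    then have "val_along g q = \<infinity>"
      unfolding val_along_def by (simp only: image_empty Inf_empty top_ereal_def)
    with assms(2) show False by simp
  qed
  moreover have "finite ?R" using assms(1) by (rule poly_roots_finite)
  ultimately have "val_along g q \<in> (\<lambda>\<gamma>. puiseux_val (poly q \<gamma>)) ` ?R"
    unfolding val_along_def by (subst cInf_eq_Min) (auto intro!: Min_in)
  then show ?thesis by auto
qed

theorem proposition63:
  fixes \<iota> :: "'a::field_char_0 \<Rightarrow> 'b::alg_closed_field"
    and f :: "'a poly poly"
    and f0 :: "'a fps poly"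
    and fs :: "nat \<Rightarrow> 'a fps poly"
    and h :: "nat \<Rightarrow> 'a fps poly"
    and r :: nat
    and p :: "nat \<Rightarrow> nat \<Rightarrow> 'a fps poly"
    and e :: "nat \<Rightarrow> nat \<Rightarrow> int"
    and \<beta> :: "nat \<Rightarrow> 'a poly poly"
    and c :: "nat \<Rightarrow> int"
  assumes \<iota>_1: "\<iota> 1 = 1"
    and \<iota>_add: "\<And>a b. \<iota> (a + b) = \<iota> a + \<iota> b"
    and \<iota>_mult: "\<And>a b. \<iota> (a * b) = \<iota> a * \<iota> b"
    and f_irreducible: "irreducible f"
    and f_monic: "lead_coeff f = 1"
    and factorization: "to_fps_poly f = f0 * (\<Prod>i\<in>{1..r}. fs i)"
    and f0_unit: "(fps_of_poly f0 :: 'a fps fps) dvd 1"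
    and fs_irreducible: "\<And>i. i \<in> {1..r} \<Longrightarrow> irreducible (fs i)"
    and fs_weierstrass: "\<And>i. i \<in> {1..r} \<Longrightarrow> weierstrass_poly (fs i)"
    and h_eq: "\<And>i. i \<in> {1..r} \<Longrightarrow> h i = (\<Prod>j\<in>{1..r} - {i}. fs j)"
    and p_0: "\<And>i. i \<in> {1..r} \<Longrightarrow> p i 0 = 1"
    and e_0: "\<And>i. i \<in> {1..r} \<Longrightarrow> e i 0 = 0"
    and p_degree: "\<And>i d. i \<in> {1..r} \<Longrightarrow> d < degree (fs i) \<Longrightarrow> degree (p i d) = d"
    and p_monic: "\<And>i d. i \<in> {1..r} \<Longrightarrow> d < degree (fs i) \<Longrightarrow> lead_coeff (p i d) = 1"
    and local_basis: "\<And>i. i \<in> {1..r} \<Longrightarrow>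
      represents_integral_basis (fs i) ((\<lambda>d. over_X_power (p i d) (e i d)) ` {..<degree (fs i)})"
    and c_nonneg: "\<And>i. i \<in> {1..r} \<Longrightarrow> c i \<ge> 0"
    and val_eq: "\<And>i. i \<in> {1..r} \<Longrightarrow>
      val_along (map_poly (fps_to_puiseux \<iota>) (fs i))
        (map_poly (fps_to_puiseux \<iota>) (to_fps_poly (\<beta> i) * h i)) = ereal (of_int (c i))"
  shows "represents_integral_basis (\<Prod>i\<in>{1..r}. fs i)
    (\<Union>i\<in>{1..r}. (\<lambda>d. over_X_power (to_fps_poly (\<beta> i) * h i * p i d) (c i + e i d)) ` {..<degree (fs i)})"
proof -
  define \<phi> where "\<phi> F = puiseux_of_fls (map_fls \<iota> F)" for F
  interpret \<iota>: unital_ring_hom \<iota>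
    using \<iota>_1 \<iota>_add \<iota>_mult by unfold_locales
  interpret valued_laurent_extension \<phi> "{x. puiseux_val x \<ge> 0}" "{x. puiseux_val x > 0}"
    using valued_laurent_extension_puiseux[OF \<iota>.unital_ring_hom_axioms] by (simp add: \<phi>_def[abs_def])
  have \<phi>_fps: "fps_to_puiseux \<iota> F = \<phi> (fps_to_fls F)" for F
    unfolding fps_to_puiseux_def \<phi>_def
    by (rule arg_cong[of _ _ puiseux_of_fls], rule fls_eqI) (simp add: \<iota>.hom_zero)
  have map_eq: "map_poly (fps_to_puiseux \<iota>) q = map_poly \<phi> (to_fls_poly q)" for q
    by (rule poly_eqI) (simp add: coeff_map_poly \<phi>_fps hom_zero)
  have val_X: "puiseux_val (\<phi> (fls_X_intpow n)) = ereal (of_int n)" for n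
  proof -
    have "map_fls \<iota> (fls_X_intpow n) = fls_X_intpow n"
      by (rule fls_eqI) (simp add: \<iota>.hom_zero \<iota>.hom_one)
    then show ?thesis by (simp add: \<phi>_def puiseux_val_of_fls)
  qed
  define w where "w i = over_X_power (to_fps_poly (\<beta> i) * h i) (c i)" for i
  have monic: "lead_coeff (fs i) = 1" if "i \<in> {1..r}" for i
    using fs_weierstrass[OF that] by (simp add: weierstrass_poly_def)
  have "\<exists>\<gamma>. ev \<gamma> (to_fls_poly (fs i)) = 0 \<and> puiseux_val (ev \<gamma> (w i)) = 0" if i: "i \<in> {1..r}" for i
  proof -
    have "coeff (map_poly \<phi> (to_fls_poly (fs i))) (degree (fs i)) = 1"
      using monic[OF i] by (simp add: hom_one)
    then have "map_poly \<phi> (to_fls_poly (fs i)) \<noteq> 0" by (metis coeff_0 zero_neq_one)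
    then obtain \<gamma> where \<gamma>: "ev \<gamma> (to_fls_poly (fs i)) = 0"
      "puiseux_val (ev \<gamma> (to_fls_poly (to_fps_poly (\<beta> i) * h i))) = ereal (of_int (c i))"
      using val_along_attained[of "map_poly (fps_to_puiseux \<iota>) (fs i)"] val_eq[OF i]
      unfolding map_eq ev_def by (metis PInfty_neq_ereal(1))
    have "ev \<gamma> (w i) = \<phi> (fls_X_intpow (- c i)) * ev \<gamma> (to_fls_poly (to_fps_poly (\<beta> i) * h i))"
      unfolding w_def over_X_power_def fls_X_powi_eq ev_def by (simp only: map_poly_hom_smult poly_smult)
    then have "puiseux_val (ev \<gamma> (w i)) = 0"
      by (simp only: puiseux_val_mult val_X \<gamma>) (simp add: zero_ereal_def)
    with \<gamma>(1) show ?thesis by blast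
  qed
  then obtain \<gamma> where root: "\<And>i. i \<in> {1..r} \<Longrightarrow> ev (\<gamma> i) (to_fls_poly (fs i)) = 0"
    and unit: "\<And>i. i \<in> {1..r} \<Longrightarrow> puiseux_val (ev (\<gamma> i) (w i)) = 0"
    by metis
  define S where "S i = (\<lambda>d. over_X_power (p i d) (e i d)) ` {..<degree (fs i)}" for i
  have "represents_integral_basis (\<Prod>i\<in>{1..r}. fs i) (\<Union>i\<in>{1..r}. (*) (w i) ` S i)"
  proof (rule represents_integral_basis_prod)
    fix i assume i: "i \<in> {1..r}"
    note fi = fs_irreducible[OF i] monic[OF i] root[OF i]
    show "prime_elem (to_fls_poly (fs i))"
      using fi by (intro prime_elem_to_fls_poly)
    show "represents_integral_basis (fs i) (S i)"
      unfolding S_def by (rule local_basis[OF i])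
    show "u * v \<in> normalization (fs i)"
      if "u \<in> normalization (fs i)" "v \<in> normalization (fs i)" for u v
      using normalization_mult[OF fi that] .
    show "w i \<in> normalization (fs i)"
      using unit[OF i] by (simp add: normalization_iff[OF fi])
    have "ev (\<gamma> i) (w i) \<noteq> 0"
      using unit[OF i] puiseux_val_eq_PInf_iff[of "ev (\<gamma> i) (w i)"] by auto
    then show "\<exists>w'\<in>normalization (fs i). to_fls_poly (fs i) dvd w i * w' - 1"
      using ex_inverse_in_normalization[OF fi] unit[OF i] by (simp add: puiseux_val_inverse)
    show "to_fls_poly (fs j) dvd w i" if j: "j \<in> {1..r}" "i \<noteq> j" for j
    proof -
      have "fs j dvd to_fps_poly (\<beta> i) * h i"
        unfolding h_eq[OF i] using j by (intro dvd_mult dvd_prodI) auto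
      then show ?thesis
        unfolding w_def over_X_power_def by (intro dvd_smult to_fls_poly_hom.hom_dvd)
    qed
  qed simp
  moreover have "(*) (w i) ` S i =
      (\<lambda>d. over_X_power (to_fps_poly (\<beta> i) * h i * p i d) (c i + e i d)) ` {..<degree (fs i)}" for i
    by (simp add: S_def w_def over_X_power_mult image_image)
  ultimately show ?thesis by simp
qed

end
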